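(* Let $n,m$ be positive integers. Write $n=am+b$ with integers $a\ge 0$ and $0\le b<m$, and set $k=\lfloor n/(a+b)\rfloor$. Then $\nu_0(\mathrm{Shift}(n,m))\ge k$.
   Context: $\mathrm{Shift}(n,m)$ is the directed Cayley graph of $\mathbb{Z}_n$ with generators $\{1,m\}$. Its vertex set is $\{0,1,\dots,n-1\}$, and it has arcs $i\to i+1 \pmod n$ and $i\to i+m \pmod n$ for every vertex $i$. Cycles are directed. For a directed graph $G$, the cycle packing number $\nu_0(G)$ is the maximum number of pairwise vertex-disjoint directed cycles in $G$. *)

theory Defs
  imports "Graph_Theory.Graph_Theory" Complex_Main
begin

text \<open>
  For \<open>m mod n = 1 mod n\<close> the two generators give the same arc, stored once; this has no influence on
  vertex-disjoint cycles. Loops (\<open>n = 1\<close> or \<open>n dvd m\<close>) are kept.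
\<close>

definition Shift :: "nat \<Rightarrow> nat \<Rightarrow> nat pair_pre_digraph" where
  "Shift n m = \<lparr> pverts = {0..<n},
     parcs = {(i, (i + 1) mod n) | i. i < n} \<union> {(i, (i + m) mod n) | i. i < n} \<rparr>"

text \<open>
  The library's \<open>cycle\<close> is a nonempty closed directed walk, given as a list of arcs, without repeated
  vertices; loops and 2-cycles are cycles. The vertices of a cycle are the tails of its arcs. The
  arc lists of one cycle read from two different starting points share their vertices, so a
  packing contains at most one of them.
\<close>

definition cycle_packing :: "('a, 'b) pre_digraph \<Rightarrow> 'b list set \<Rightarrow> bool" where
  "cycle_packing G C \<longleftrightarrow>
     (\<forall>p\<in>C. pre_digraph.cycle G p) \<and>
     pairwise (\<lambda>p q. disjnt (tail G ` set p) (tail G ` set q)) C"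

definition cycle_packing_number :: "('a, 'b) pre_digraph \<Rightarrow> nat" (\<open>\<nu>\<^sub>0\<close>) where
  "\<nu>\<^sub>0 G = Max {card C | C. finite C \<and> cycle_packing G C}"

text \<open>The maximum is taken over a finite nonempty set if the graph is finite.\<close>

lemma card_cycle_packing_le:
  assumes "fin_digraph G" "cycle_packing G C"
  shows "finite C" "card C \<le> card (verts G)"
proof -
  interpret fin_digraph G by fact
  define f where "f p = tail G (hd p)" for p
  have ne: "p \<noteq> []" and sub: "set p \<subseteq> arcs G" if "p \<in> C" for p
    using assms(2) that unfolding cycle_packing_def cycle_def awalk_def by blast+
  have inj: "inj_on f C"
  proof (rule inj_onI, rule ccontr)
    fix p q assume pq: "p \<in> C" "q \<in> C" "f p = f q" "p \<noteq> q"
    then have "disjnt (tail G ` set p) (tail G ` set q)"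
      using assms(2) unfolding cycle_packing_def pairwise_def by blast
    moreover have "f p \<in> tail G ` set p" "f p \<in> tail G ` set q"
      using imageI[OF hd_in_set[OF ne[OF pq(1)]], of "tail G"]
        imageI[OF hd_in_set[OF ne[OF pq(2)]], of "tail G"] pq(3) by (simp_all add: f_def)
    ultimately show False by (auto simp: disjnt_def)
  qed
  have img: "f ` C \<subseteq> verts G"
  proof (rule image_subsetI)
    fix p assume "p \<in> C"
    then have "hd p \<in> arcs G" using ne sub hd_in_set by blast
    then show "f p \<in> verts G" by (simp add: f_def)
  qed
  show "finite C" by (rule finite_imageD[OF finite_subset[OF img finite_verts] inj])
  show "card C \<le> card (verts G)" using inj img finite_verts by (rule card_inj_on_le)
qed

lemma cycle_packing_cards:
  assumes "fin_digraph G"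
  shows "finite {card C | C. finite C \<and> cycle_packing G C}"
    and "{card C | C. finite C \<and> cycle_packing G C} \<noteq> {}"
proof -
  have "{card C | C. finite C \<and> cycle_packing G C} \<subseteq> {..card (verts G)}"
    using card_cycle_packing_le[OF assms] by auto
  then show "finite {card C | C. finite C \<and> cycle_packing G C}"
    by (rule finite_subset) simp
  have "cycle_packing G {}" by (simp add: cycle_packing_def)
  then show "{card C | C. finite C \<and> cycle_packing G C} \<noteq> {}" by blast
qed

lemma pair_fin_digraph_Shift: "pair_fin_digraph (Shift n m)"
  by unfold_locales (auto simp: Shift_def)

end

theory Submission
  imports Defs "HOL-Library.Disjoint_Sets"
begin

text \<open>
  Multiplication by \<open>a\<close> modulo \<open>n = a m + b\<close> turns the arc \<open>x \<rightarrow> x + 1\<close> into the translation by \<open>a\<close>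
  and the arc \<open>x \<rightarrow> x + m\<close> into the translation by \<open>- b\<close>. From every point of an interval of \<open>a + b\<close>
  consecutive integers, one of these two translations stays in the interval. Hence for each of the
  \<open>k\<close> disjoint blocks \<open>[j (a + b), (j + 1) (a + b))\<close> in \<open>[0, n)\<close>, every vertex \<open>x\<close> with \<open>a x mod n\<close>
  in the block has an out-neighbour of the same kind, and a walk along such vertices closes a cycle.
\<close>

lemma (in wf_digraph) ex_awalk_of_length:
  assumes out: "\<And>u. u \<in> verts G \<Longrightarrow> out_arcs G u \<noteq> {}"
    and "u \<in> verts G"
  shows "\<exists>p v. awalk u p v \<and> length p = l"
  using \<open>u \<in> verts G\<close>
proof (induction l arbitrary: u)
  case 0
  then have "awalk u [] u" by (simp add: awalk_Nil_iff)
  then show ?case by auto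
next
  case (Suc l)
  obtain e where e: "e \<in> arcs G" "tail G e = u"
    using out[OF Suc.prems] by (auto simp: out_arcs_def)
  obtain p v where "awalk (head G e) p v" "length p = l"
    using Suc.IH head_in_verts[OF e(1)] by blast
  with e have "awalk u (e # p) v" "length (e # p) = Suc l"
    by (simp_all add: awalk_Cons_iff)
  then show ?case by blast
qed

lemma (in wf_digraph) ex_cycle_if_out_arcs:
  assumes "finite (verts G)" "verts G \<noteq> {}"
    and out: "\<And>u. u \<in> verts G \<Longrightarrow> out_arcs G u \<noteq> {}"
  shows "\<exists>p. cycle p"
proof -
  obtain u p v where p: "awalk u p v" "length p = card (verts G)"
    using ex_awalk_of_length[OF out] \<open>verts G \<noteq> {}\<close> by blast
  have "card (set (awalk_verts u p)) \<le> card (verts G)"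
    using p(1) \<open>finite (verts G)\<close> by (auto intro: card_mono)
  then have "\<not> distinct (awalk_verts u p)"
    using p(2) by (auto simp: length_awalk_verts dest: distinct_card)
  then obtain q where "closed_w q"
    using awalk_not_distinct_decomp[OF p(1)] by (auto simp: closed_w_def)
  then show ?thesis by (rule closed_w_imp_cycle)
qed

lemma (in wf_digraph) ex_cycle_in_induce_subgraph:
  assumes "finite S" "S \<noteq> {}" "S \<subseteq> verts G"
    and out: "\<And>u. u \<in> S \<Longrightarrow> out_arcs (G \<restriction> S) u \<noteq> {}"
  shows "\<exists>p. cycle p \<and> tail G ` set p \<subseteq> S"
proof -
  have induced: "induced_subgraph (G \<restriction> S) G"
    using \<open>S \<subseteq> verts G\<close> by (rule induced_induce)
  interpret H: wf_digraph "G \<restriction> S"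
    using induced by (rule wf_digraphI_induced)
  obtain p where p: "H.cycle p"
    using H.ex_cycle_if_out_arcs assms by auto
  then have "tail G ` set p \<subseteq> S"
    by (auto simp: H.cycle_def H.awalk_def)
  moreover have "cycle p"
    using induced_imp_subgraph[OF induced] p by (rule subgraph_cycle)
  ultimately show ?thesis by blast
qed

lemma card_le_cycle_packing_number:
  assumes "fin_digraph G" "cycle_packing G C"
  shows "card C \<le> \<nu>\<^sub>0 G"
  unfolding cycle_packing_number_def
  using assms cycle_packing_cards(1) card_cycle_packing_le(1) by (blast intro: Max_ge)

lemma card_index_le_cycle_packing_number:
  assumes "fin_digraph G" "disjoint_family_on S I"
    and cycle: "\<And>i. i \<in> I \<Longrightarrow> \<exists>p. pre_digraph.cycle G p \<and> tail G ` set p \<subseteq> S i"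
  shows "card I \<le> \<nu>\<^sub>0 G"
proof -
  obtain p where p: "\<And>i. i \<in> I \<Longrightarrow> pre_digraph.cycle G (p i)"
      "\<And>i. i \<in> I \<Longrightarrow> tail G ` set (p i) \<subseteq> S i"
    using cycle by metis
  have disjoint: "disjnt (tail G ` set (p i)) (tail G ` set (p j))"
    if "i \<in> I" "j \<in> I" "i \<noteq> j" for i j
    using p(2) that disjoint_family_onD[OF \<open>disjoint_family_on S I\<close>]
    unfolding disjnt_def by blast
  have "p i \<noteq> []" if "i \<in> I" for i
    using p(1)[OF that] by (auto simp: pre_digraph.cycle_def)
  then have "inj_on p I"
    using disjoint by (fastforce simp: inj_on_def disjnt_def)
  moreover have "cycle_packing G (p ` I)"
    using p(1) disjoint by (auto simp: cycle_packing_def pairwise_def)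
  ultimately show ?thesis
    using card_le_cycle_packing_number[OF \<open>fin_digraph G\<close>] by (metis card_image)
qed

definition mult_residue_block :: "nat \<Rightarrow> nat \<Rightarrow> nat \<Rightarrow> nat \<Rightarrow> nat set" where
  "mult_residue_block n a c j = {x. x < n \<and> a * x mod n div c = j}"

lemma disjoint_family_mult_residue_block: "disjoint_family_on (mult_residue_block n a c) J"
  by (auto simp: disjoint_family_on_def mult_residue_block_def)

lemma mod_in_mult_residue_block:
  assumes "0 < n" "Suc j * c \<le> n"
    and q: "a * y mod n = q mod n" "j * c \<le> q" "q < Suc j * c"
  shows "y mod n \<in> mult_residue_block n a c j"
proof -
  have "q mod n = q" "q div c = j"
    using assms by (auto intro: div_nat_eqI simp: mult.commute)
  then show ?thesis
    using q(1) \<open>0 < n\<close> by (simp add: mult_residue_block_def mod_mult_right_eq)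
qed

lemma mult_residue_block_nonempty:
  assumes "0 < a" "a \<le> c" "Suc j * c \<le> n"
  shows "mult_residue_block n a c j \<noteq> {}"
proof -
  \<comment> \<open>The multiples of \<open>a\<close> do not skip an interval of length \<open>c \<ge> a\<close>; \<open>a * x\<close> is the least
     one that is at least \<open>j * c\<close>.\<close>
  define x where "x = (j * c + (a - 1)) div a"
  have "a * x + (j * c + (a - 1)) mod a = j * c + (a - 1)"
    unfolding x_def by (rule mult_div_mod_eq)
  moreover have "(j * c + (a - 1)) mod a < a"
    using \<open>0 < a\<close> by simp
  ultimately have "j * c \<le> a * x" "a * x < Suc j * c"
    using \<open>0 < a\<close> \<open>a \<le> c\<close> unfolding mult_Suc by linarith+
  moreover have "0 < n" using assms by (auto intro: gr0I)
  ultimately show ?thesis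
    using mod_in_mult_residue_block \<open>Suc j * c \<le> n\<close> by blast
qed

lemma mult_residue_block_step:
  assumes n: "n = a * m + b" and block: "Suc j * (a + b) \<le> n"
    and x: "x \<in> mult_residue_block n a (a + b) j"
  shows "\<exists>y \<in> mult_residue_block n a (a + b) j. y = (x + 1) mod n \<or> y = (x + m) mod n"
proof -
  define p where "p = a * x mod n"
  have "0 < n" and "p div (a + b) = j"
    using x by (auto simp: mult_residue_block_def p_def)
  moreover from this have "0 < a + b"
    using n by (auto intro: gr0I)
  ultimately have p: "p = j * (a + b) + p mod (a + b)" "p mod (a + b) < a + b"
    by (auto simp: div_mult_mod_eq)
  note in_block = mod_in_mult_residue_block[OF \<open>0 < n\<close> block]
  show ?thesis
  proof (cases "p mod (a + b) < b")
    case True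
    have "a * (x + 1) mod n = (p + a) mod n"
      by (simp add: p_def mod_simps algebra_simps)
    moreover have "j * (a + b) \<le> p + a" "p + a < Suc j * (a + b)"
      using True p unfolding mult_Suc by linarith+
    ultimately show ?thesis using in_block by blast
  next
    case False
    have "a * (x + m) mod n = (p + a * m) mod n"
      by (simp add: p_def mod_simps algebra_simps)
    also have "p + a * m = (p - b) + n"
      using False p n by linarith
    finally have "a * (x + m) mod n = (p - b) mod n" by simp
    moreover have "j * (a + b) \<le> p - b" "p - b < Suc j * (a + b)"
      using False p unfolding mult_Suc by linarith+
    ultimately show ?thesis using in_block by blast
  qed
qed

lemma fin_digraph_Shift: "fin_digraph (with_proj (Shift n m))"
proof -
  interpret pair_fin_digraph "Shift n m" by (rule pair_fin_digraph_Shift)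
  show ?thesis by unfold_locales
qed

lemma ex_cycle_in_mult_residue_block:
  assumes "0 < n" "n = a * m + b" "Suc j * (a + b) \<le> n"
  defines "S \<equiv> mult_residue_block n a (a + b) j"
  shows "\<exists>p. pre_digraph.cycle (with_proj (Shift n m)) p \<and>
    tail (with_proj (Shift n m)) ` set p \<subseteq> S"
proof -
  interpret fin_digraph "with_proj (Shift n m)" by (rule fin_digraph_Shift)
  have S_verts: "S \<subseteq> {0..<n}"
    by (auto simp: S_def mult_residue_block_def)
  show ?thesis
  proof (rule ex_cycle_in_induce_subgraph)
    show "S \<subseteq> verts (with_proj (Shift n m))" "finite S"
      using S_verts finite_subset by (auto simp: Shift_def)
    show "S \<noteq> {}"
    proof (cases "a = 0")
      case True
      then have "0 \<in> S"
        using assms by (auto simp: mult_residue_block_def)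
      then show ?thesis by blast
    next
      case False
      then show ?thesis
        unfolding S_def using assms(3) by (intro mult_residue_block_nonempty) auto
    qed
    show "out_arcs (with_proj (Shift n m) \<restriction> S) x \<noteq> {}" if "x \<in> S" for x
    proof -
      obtain y where "y \<in> S" "y = (x + 1) mod n \<or> y = (x + m) mod n"
        using mult_residue_block_step[OF assms(2,3)] \<open>x \<in> S\<close> unfolding S_def by blast
      then have "(x, y) \<in> out_arcs (with_proj (Shift n m) \<restriction> S) x"
        using \<open>x \<in> S\<close> S_verts by (auto simp: Shift_def)
      then show ?thesis by blast
    qed
  qed
qed

theorem theorem6:
  fixes n m a b k :: nat
  assumes "n > 0" and "m > 0"
    and "n = a * m + b" and "b < m"
    and "k = nat \<lfloor>real n / real (a + b)\<rfloor>"
  shows "\<nu>\<^sub>0 (with_proj (Shift n m)) \<ge> k"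
proof -
  have "k = n div (a + b)"
    unfolding assms(5) by (simp only: floor_divide_of_nat_eq nat_int)
  then have "Suc j * (a + b) \<le> n" if "j < k" for j
    using that div_times_less_eq_dividend[of n "a + b"] by (metis Suc_leI le_trans mult_le_mono1)
  then have "card {..<k} \<le> \<nu>\<^sub>0 (with_proj (Shift n m))"
    using ex_cycle_in_mult_residue_block[OF assms(1,3)] fin_digraph_Shift
      disjoint_family_mult_residue_block
    by (intro card_index_le_cycle_packing_number) auto
  then show ?thesis by simp
qed

end
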